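(* Let $V,b:\mathbb{T}\to\mathbb{R}$ be smooth with $\int_{\mathbb{T}}b\,dx=0$, let $\beta>0$, let $M\in\mathbb{N}$ and let $x_1,\dots,x_M\in\mathbb{T}$ be sample points. Let $\mathcal{U}\subset C^2(\mathbb{T})$ and $\mathcal{V}\subset C^1(\mathbb{T})$ be the reproducing kernel Hilbert spaces associated with positive definite kernels $K_1$ and $K_2$ on $\mathbb{T}$. Consider the minimization problem (P): minimize $$\|u\|_{\mathcal{U}}^2+\|m\|_{\mathcal{V}}^2+|\overline{H}|^2+\beta\Big|\frac1M\sum_{i=1}^M m(x_i)-1\Big|^2+\beta\Big|\frac1M\sum_{i=1}^M u(x_i)\Big|^2$$ over $(u,m,\overline{H})\in\mathcal{U}\times\mathcal{V}\times\mathbb{R}$ subject to, for all $i=1,\dots,M$, $$H(x_i,u_x(x_i))=\ln m(x_i)+\overline{H},\qquad m_x(x_i)(u_x(x_i)+b(x_i))+m(x_i)(u_{xx}(x_i)+b_x(x_i))=0 .$$ Consider also the finite-dimensional problem (F): minimize $$\boldsymbol{z}^TK_1(\boldsymbol{\phi},\boldsymbol{\phi})^{-1}\boldsymbol{z}+\boldsymbol{\rho}^TK_2(\boldsymbol{\psi},\boldsymbol{\psi})^{-1}\boldsymbol{\rho}+|\lambda|^2+\beta\Big|\frac1M\sum_{i=1}^M\rho_i^{(1)}-1\Big|^2+\beta\Big|\frac1M\sum_{i=1}^Mz_i^{(1)}\Big|^2$$ over $\boldsymbol{z}\in\mathbb{R}^{3M}$, $\boldsymbol{\rho}\in\mathbb{R}^{2M}$,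 $\lambda\in\mathbb{R}$ subject to, for all $i=1,\dots,M$, $$H(x_i,z_i^{(2)})=\ln\rho_i^{(1)}+\lambda,\qquad \rho_i^{(2)}(z_i^{(2)}+b(x_i))+\rho_i^{(1)}(z_i^{(3)}+b_x(x_i))=0 .$$ Then (P) admits a minimizer $(u^\dagger,m^\dagger,\overline{H}^\dagger)$ such that $$u^\dagger(x)=\langle K_1(x,\boldsymbol{\phi}),K_1(\boldsymbol{\phi},\boldsymbol{\phi})^{-1}\boldsymbol{z}^\dagger\rangle,\qquad m^\dagger(x)=\langle K_2(x,\boldsymbol{\psi}),K_2(\boldsymbol{\psi},\boldsymbol{\psi})^{-1}\boldsymbol{\rho}^\dagger\rangle,\qquad \overline{H}^\dagger=\lambda^\dagger,$$ where $(\boldsymbol{z}^\dagger,\boldsymbol{\rho}^\dagger,\lambda^\dagger)$ is a minimizer of (F).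
   Context: $\mathbb{T}$ is the one-dimensional torus, identified with $[0,1)$. $H(x,p):=V(x)+\frac{p^2}{2}+b(x)p$ for $x\in\mathbb{T}$, $p\in\mathbb{R}$. Constraints involving $\ln$ require the argument to be positive. The underlying stationary mean field game is: find $(u,m,\overline{H})\in C^\infty(\mathbb{T})\times C^\infty(\mathbb{T})\times\mathbb{R}$ with $\frac{u_x^2}{2}+V(x)+b(x)u_x=\ln m+\overline{H}$ and $-(m(u_x+b(x)))_x=0$ on $\mathbb{T}$, $\int_{\mathbb{T}}m\,dx=1$, $\int_{\mathbb{T}}u\,dx=0$. When $\int_{\mathbb{T}}b\,dx=0$ it is known to have a unique smooth solution. Vectors are written $\boldsymbol{z}=(z^{(1)}_1,\dots,z^{(1)}_M,z^{(2)}_1,\dots,z^{(2)}_M,z^{(3)}_1,\dots,z^{(3)}_M)$ and $\boldsymbol{\rho}=(\rho^{(1)}_1,\dots,\rho^{(1)}_M,\rho^{(2)}_1,\dots,\rho^{(2)}_M)$. Define the functionals $\phi_i^{(1)}=\delta_{x_i}$, $\phi_i^{(2)}=\delta_{x_i}\circ\partial_x$, $\phi_i^{(3)}=\delta_{x_i}\circ\partial_{xx}$ ($i=1,\dots,M$), where $\delta_x$ is the Dirac delta at $x$. $\boldsymbol{\phi}$ is the $3M$-vector obtained by concatenating $\boldsymbol{\phi}^{(1)},\boldsymbol{\phi}^{(2)},\boldsymbol{\phi}^{(3)}$, and $\boldsymbol{\psi}$ the $2M$-vector obtained by concatenating $\boldsymbol{\phi}^{(1)},\boldsymbol{\phi}^{(2)}$;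 their components are $\phi_i$, $\psi_i$. For $k=1,2$, $K_k(x,\boldsymbol{\phi})$ is the vector whose $i$-th entry is $\phi_i$ applied to $K_k(x,\cdot)$, i.e. $\int_{\mathbb{T}}K_k(x,x')\phi_i(x')\,dx'$, and the gram matrix $K_k(\boldsymbol{\phi},\boldsymbol{\phi})$ has entries $\int_{\mathbb{T}}\int_{\mathbb{T}}K_k(x,x')\phi_i(x)\phi_j(x')\,dx\,dx'$ ($\phi_i$ applied in the first variable, $\phi_j$ in the second); $K_k(x,\boldsymbol{\psi})$ and $K_k(\boldsymbol{\psi},\boldsymbol{\psi})$ are defined in the same way. The gram matrices $K_1(\boldsymbol{\phi},\boldsymbol{\phi})$ and $K_2(\boldsymbol{\psi},\boldsymbol{\psi})$ are assumed invertible. *)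

theory Defs
  imports "HOL-Analysis.Analysis"
begin

text \<open>The torus is represented by \<open>[0,1)\<close>; a function on it is a 1-periodic function on the
  reals, so that derivatives on the torus are ordinary derivatives.\<close>

definition torus :: "real set" where
  "torus = {0..<1}"

definition torus_fun :: "(real \<Rightarrow> real) \<Rightarrow> bool" where
  "torus_fun f \<longleftrightarrow> (\<forall>x. f (x + 1) = f x)"

definition torus_C :: "nat \<Rightarrow> (real \<Rightarrow> real) set" where
  "torus_C k = {f. torus_fun f \<and>
     (\<forall>j<k. (deriv ^^ j) f differentiable_on UNIV) \<and> continuous_on UNIV ((deriv ^^ k) f)}"

definition torus_smooth :: "(real \<Rightarrow> real) set" where
  "torus_smooth = (\<Inter>k. torus_C k)"

text \<open>Positive definiteness is meant in the sense usual for reproducing kernels: the quadratic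
  forms are nonnegative, not necessarily strictly positive.\<close>

definition pos_def_kernel :: "(real \<Rightarrow> real \<Rightarrow> real) \<Rightarrow> bool" where
  "pos_def_kernel K \<longleftrightarrow>
     (\<forall>x y. K (x + 1) y = K x y \<and> K x (y + 1) = K x y) \<and>
     (\<forall>x y. K x y = K y x) \<and>
     (\<forall>S c. finite S \<and> S \<subseteq> torus \<longrightarrow> (\<Sum>x\<in>S. \<Sum>y\<in>S. c x * c y * K x y) \<ge> 0)"

text \<open>Hilbert spaces of functions: a set \<open>F\<close> of functions with an inner product \<open>ip\<close>, of which
  only the values on \<open>F\<close> matter.\<close>

definition ip_norm :: "((real \<Rightarrow> real) \<Rightarrow> (real \<Rightarrow> real) \<Rightarrow> real) \<Rightarrow> (real \<Rightarrow> real) \<Rightarrow> real" where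
  "ip_norm ip f = sqrt (ip f f)"

definition hilbert_function_space ::
  "(real \<Rightarrow> real) set \<Rightarrow> ((real \<Rightarrow> real) \<Rightarrow> (real \<Rightarrow> real) \<Rightarrow> real) \<Rightarrow> bool" where
  "hilbert_function_space F ip \<longleftrightarrow>
     (\<lambda>x. 0) \<in> F \<and>
     (\<forall>f\<in>F. \<forall>g\<in>F. (\<lambda>x. f x + g x) \<in> F) \<and>
     (\<forall>f\<in>F. \<forall>c. (\<lambda>x. c * f x) \<in> F) \<and>
     (\<forall>f\<in>F. \<forall>g\<in>F. ip f g = ip g f) \<and>
     (\<forall>f\<in>F. \<forall>g\<in>F. \<forall>h\<in>F. ip (\<lambda>x. f x + g x) h = ip f h + ip g h) \<and>
     (\<forall>f\<in>F. \<forall>g\<in>F. \<forall>c. ip (\<lambda>x. c * f x) g = c * ip f g) \<and>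
     (\<forall>f\<in>F. ip f f \<ge> 0 \<and> (ip f f = 0 \<longrightarrow> f = (\<lambda>x. 0))) \<and>
     (\<forall>s. (\<forall>n::nat. s n \<in> F) \<and>
          (\<forall>e>0. \<exists>N. \<forall>m\<ge>N. \<forall>n\<ge>N. ip_norm ip (\<lambda>x. s m x - s n x) < e) \<longrightarrow>
          (\<exists>f\<in>F. (\<lambda>n. ip_norm ip (\<lambda>x. s n x - f x)) \<longlonglongrightarrow> 0))"

definition rkhs ::
  "(real \<Rightarrow> real \<Rightarrow> real) \<Rightarrow> (real \<Rightarrow> real) set
    \<Rightarrow> ((real \<Rightarrow> real) \<Rightarrow> (real \<Rightarrow> real) \<Rightarrow> real) \<Rightarrow> bool" where
  "rkhs K F ip \<longleftrightarrow>
     hilbert_function_space F ip \<and> (\<forall>f\<in>F. torus_fun f) \<and>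
     (\<forall>x\<in>torus. K x \<in> F \<and> (\<forall>f\<in>F. ip f (K x) = f x))"

text \<open>\<open>dirac_deriv k x\<close> is \<open>\<delta>\<^sub>x\<close> composed with the \<open>k\<close>-th derivative. The number \<open>M\<close> of sample
  points is the cardinality of the type \<open>'n\<close>, and the blocks of a concatenated vector are the
  summands of its index type: \<open>Inl i\<close>, \<open>Inr (Inl i)\<close>, \<open>Inr (Inr i)\<close> index the blocks (1), (2), (3)
  of a \<open>3M\<close>-vector, and \<open>Inl i\<close>, \<open>Inr i\<close> the blocks (1), (2) of a \<open>2M\<close>-vector.\<close>

definition dirac_deriv :: "nat \<Rightarrow> real \<Rightarrow> (real \<Rightarrow> real) \<Rightarrow> real" where
  "dirac_deriv k x f = (deriv ^^ k) f x"

fun phi :: "('n \<Rightarrow> real) \<Rightarrow> 'n + 'n + 'n \<Rightarrow> (real \<Rightarrow> real) \<Rightarrow> real" where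
  "phi x (Inl i) = dirac_deriv 0 (x i)"
| "phi x (Inr (Inl i)) = dirac_deriv 1 (x i)"
| "phi x (Inr (Inr i)) = dirac_deriv 2 (x i)"

fun psi :: "('n \<Rightarrow> real) \<Rightarrow> 'n + 'n \<Rightarrow> (real \<Rightarrow> real) \<Rightarrow> real" where
  "psi x (Inl i) = dirac_deriv 0 (x i)"
| "psi x (Inr i) = dirac_deriv 1 (x i)"

definition kernel_vec ::
  "(real \<Rightarrow> real \<Rightarrow> real) \<Rightarrow> ('k::finite \<Rightarrow> (real \<Rightarrow> real) \<Rightarrow> real) \<Rightarrow> real \<Rightarrow> real ^ 'k" where
  "kernel_vec K L y = (\<chi> i. L i (\<lambda>y'. K y y'))"

definition gram ::
  "(real \<Rightarrow> real \<Rightarrow> real) \<Rightarrow> ('k::finite \<Rightarrow> (real \<Rightarrow> real) \<Rightarrow> real) \<Rightarrow> real ^ 'k ^ 'k" where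
  "gram K L = (\<chi> i j. L i (\<lambda>y. L j (\<lambda>y'. K y y')))"

definition hamiltonian :: "(real \<Rightarrow> real) \<Rightarrow> (real \<Rightarrow> real) \<Rightarrow> real \<Rightarrow> real \<Rightarrow> real" where
  "hamiltonian V b x p = V x + p\<^sup>2 / 2 + b x * p"

definition P_objective ::
  "((real \<Rightarrow> real) \<Rightarrow> (real \<Rightarrow> real) \<Rightarrow> real) \<Rightarrow> ((real \<Rightarrow> real) \<Rightarrow> (real \<Rightarrow> real) \<Rightarrow> real)
    \<Rightarrow> real \<Rightarrow> ('n::finite \<Rightarrow> real) \<Rightarrow> (real \<Rightarrow> real) \<times> (real \<Rightarrow> real) \<times> real \<Rightarrow> real" where
  "P_objective ipU ipV \<beta> x = (\<lambda>(u, m, h).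
     (ip_norm ipU u)\<^sup>2 + (ip_norm ipV m)\<^sup>2 + \<bar>h\<bar>\<^sup>2
       + \<beta> * \<bar>1 / real CARD('n) * (\<Sum>i\<in>UNIV. m (x i)) - 1\<bar>\<^sup>2
       + \<beta> * \<bar>1 / real CARD('n) * (\<Sum>i\<in>UNIV. u (x i))\<bar>\<^sup>2)"

definition P_feasible ::
  "(real \<Rightarrow> real) set \<Rightarrow> (real \<Rightarrow> real) set \<Rightarrow> (real \<Rightarrow> real) \<Rightarrow> (real \<Rightarrow> real)
    \<Rightarrow> ('n::finite \<Rightarrow> real) \<Rightarrow> (real \<Rightarrow> real) \<times> (real \<Rightarrow> real) \<times> real \<Rightarrow> bool" where
  "P_feasible FU FV V b x = (\<lambda>(u, m, h).
     u \<in> FU \<and> m \<in> FV \<and>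
     (\<forall>i. m (x i) > 0 \<and>
          hamiltonian V b (x i) (deriv u (x i)) = ln (m (x i)) + h \<and>
          deriv m (x i) * (deriv u (x i) + b (x i))
            + m (x i) * (deriv (deriv u) (x i) + deriv b (x i)) = 0))"

definition F_objective ::
  "(real \<Rightarrow> real \<Rightarrow> real) \<Rightarrow> (real \<Rightarrow> real \<Rightarrow> real) \<Rightarrow> real \<Rightarrow> ('n::finite \<Rightarrow> real)
    \<Rightarrow> (real ^ ('n + 'n + 'n)) \<times> (real ^ ('n + 'n)) \<times> real \<Rightarrow> real" where
  "F_objective K1 K2 \<beta> x = (\<lambda>(z, \<rho>, l).
     z \<bullet> (matrix_inv (gram K1 (phi x)) *v z)
       + \<rho> \<bullet> (matrix_inv (gram K2 (psi x)) *v \<rho>) + \<bar>l\<bar>\<^sup>2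
       + \<beta> * \<bar>1 / real CARD('n) * (\<Sum>i\<in>UNIV. \<rho> $ Inl i) - 1\<bar>\<^sup>2
       + \<beta> * \<bar>1 / real CARD('n) * (\<Sum>i\<in>UNIV. z $ Inl i)\<bar>\<^sup>2)"

definition F_feasible ::
  "(real \<Rightarrow> real) \<Rightarrow> (real \<Rightarrow> real) \<Rightarrow> ('n::finite \<Rightarrow> real)
    \<Rightarrow> (real ^ ('n + 'n + 'n)) \<times> (real ^ ('n + 'n)) \<times> real \<Rightarrow> bool" where
  "F_feasible V b x = (\<lambda>(z, \<rho>, l).
     \<forall>i. \<rho> $ Inl i > 0 \<and>
         hamiltonian V b (x i) (z $ Inr (Inl i)) = ln (\<rho> $ Inl i) + l \<and>
         \<rho> $ Inr i * (z $ Inr (Inl i) + b (x i))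
           + \<rho> $ Inl i * (z $ Inr (Inr i) + deriv b (x i)) = 0)"

end

theory Submission
  imports Defs
begin

text \<open>
  The objective and the constraints see \<open>u\<close> and \<open>m\<close> through their norms and through finitely many
  data: values and derivatives at the sample points. In a Hilbert space where these data are
  given by bounded functionals, the function of least norm with prescribed data \<open>z\<close> is the
  orthogonal projection of any function with these data onto the span of the representers. Its
  squared norm is \<open>z\<^sup>T G\<^sup>-\<^sup>1 z\<close> with the Gram matrix \<open>G\<close> of the representers, and \<open>G\<close> is the given
  kernel matrix because the representer of \<open>\<phi>\<^sub>i\<close> is \<open>y \<mapsto> K(y, \<phi>\<^sub>i)\<close> by the reproducing property
  (\<open>kernel_vec_representer\<close>, \<open>gram_representer\<close>). Hence replacing \<open>u\<close> and \<open>m\<close> by the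
  interpolants of their data keeps feasibility and does not increase the objective
  (\<open>inv_gram_form_le_nrm\<close>), and on interpolants the two problems coincide: the interpolants of a
  minimizer of the finite-dimensional problem minimize the original one.

  Two things remain. First, derivatives at a point have representers
  (\<open>derivative_representer\<close>). Since the functions of the space are differentiable, the derivative
  is the pointwise limit of difference quotients, which are combinations of point evaluations.
  By the uniform boundedness principle the limit functional is bounded, and the Riesz theorem
  represents it (\<open>representable_limit\<close>). Higher derivatives follow by iteration.

  Second, the finite-dimensional problem has a minimizer (\<open>F_minimizer_exists\<close>). The feasible set
  is nonempty, and it is closed because the first constraint can be solved for the density as
  an exponential. Sublevel sets of the continuous objective are bounded because \<open>z\<^sup>T G\<^sup>-\<^sup>1 z\<close> is the
  squared norm of the interpolant and controls the data \<open>z\<close> by the Cauchy-Schwarz inequality.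
\<close>

section \<open>Hilbert spaces of functions\<close>

locale function_hilbert_space =
  fixes F :: "(real \<Rightarrow> real) set" and ip :: "(real \<Rightarrow> real) \<Rightarrow> (real \<Rightarrow> real) \<Rightarrow> real"
  assumes hilbert: "hilbert_function_space F ip"
begin

abbreviation nrm :: "(real \<Rightarrow> real) \<Rightarrow> real" where
  "nrm \<equiv> ip_norm ip"

lemmas space_axioms = hilbert[unfolded hilbert_function_space_def]

lemma zero_mem [simp]: "(\<lambda>x. 0) \<in> F"
  using space_axioms by (rule conjunct1)

lemma add_mem [simp]: "f \<in> F \<Longrightarrow> g \<in> F \<Longrightarrow> (\<lambda>x. f x + g x) \<in> F"
  using space_axioms[THEN conjunct2, THEN conjunct1, rule_format] .

lemma scale_mem [simp]: "f \<in> F \<Longrightarrow> (\<lambda>x. c * f x) \<in> F"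
  using space_axioms[THEN conjunct2, THEN conjunct2, THEN conjunct1, rule_format] .

lemma ip_commute: "f \<in> F \<Longrightarrow> g \<in> F \<Longrightarrow> ip f g = ip g f"
  using space_axioms[THEN conjunct2, THEN conjunct2, THEN conjunct2, THEN conjunct1, rule_format] .

lemma ip_add_left [simp]:
  "f \<in> F \<Longrightarrow> g \<in> F \<Longrightarrow> h \<in> F \<Longrightarrow> ip (\<lambda>x. f x + g x) h = ip f h + ip g h"
  using space_axioms[THEN conjunct2, THEN conjunct2, THEN conjunct2, THEN conjunct2, THEN conjunct1,
      rule_format] .

lemma ip_scale_left [simp]: "f \<in> F \<Longrightarrow> g \<in> F \<Longrightarrow> ip (\<lambda>x. c * f x) g = c * ip f g"
  using space_axioms[THEN conjunct2, THEN conjunct2, THEN conjunct2, THEN conjunct2, THEN conjunct2,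
      THEN conjunct1, rule_format] .

lemma ip_nonneg [simp]: "f \<in> F \<Longrightarrow> ip f f \<ge> 0"
  and ip_eq_0D: "f \<in> F \<Longrightarrow> ip f f = 0 \<Longrightarrow> f = (\<lambda>x. 0)"
  using space_axioms[THEN conjunct2, THEN conjunct2, THEN conjunct2, THEN conjunct2, THEN conjunct2,
      THEN conjunct2, THEN conjunct1] by blast+

lemma complete:
  assumes "\<And>n::nat. s n \<in> F"
    and "\<And>e. e > 0 \<Longrightarrow> \<exists>N. \<forall>m\<ge>N. \<forall>n\<ge>N. nrm (\<lambda>x. s m x - s n x) < e"
  obtains f where "f \<in> F" "(\<lambda>n. nrm (\<lambda>x. s n x - f x)) \<longlonglongrightarrow> 0"
  using space_axioms[THEN conjunct2, THEN conjunct2, THEN conjunct2, THEN conjunct2, THEN conjunct2,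
      THEN conjunct2, THEN conjunct2, rule_format, of s] assms by blast

lemma diff_mem [simp]:
  assumes "f \<in> F" "g \<in> F" shows "(\<lambda>x. f x - g x) \<in> F"
  using add_mem[OF assms(1) scale_mem[OF assms(2), of "-1"]] by simp

lemma ip_add_right [simp]:
  "f \<in> F \<Longrightarrow> g \<in> F \<Longrightarrow> h \<in> F \<Longrightarrow> ip h (\<lambda>x. f x + g x) = ip h f + ip h g"
  using ip_commute[of h "\<lambda>x. f x + g x"] ip_commute[of h f] ip_commute[of h g] by simp

lemma ip_scale_right [simp]: "f \<in> F \<Longrightarrow> g \<in> F \<Longrightarrow> ip g (\<lambda>x. c * f x) = c * ip g f"
  using ip_commute[of g "\<lambda>x. c * f x"] ip_commute[of g f] by simp

lemma ip_diff_left [simp]: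
  assumes "f \<in> F" "g \<in> F" "h \<in> F" shows "ip (\<lambda>x. f x - g x) h = ip f h - ip g h"
  using ip_add_left[OF assms(1) scale_mem[OF assms(2), of "-1"] assms(3)]
    ip_scale_left[OF assms(2,3), of "-1"] by simp

lemma ip_diff_right [simp]:
  assumes "f \<in> F" "g \<in> F" "h \<in> F" shows "ip h (\<lambda>x. f x - g x) = ip h f - ip h g"
  using ip_commute[of h "\<lambda>x. f x - g x"] ip_commute[of h f] ip_commute[of h g] assms by simp

lemma ip_zero_left [simp]: "f \<in> F \<Longrightarrow> ip (\<lambda>x. 0) f = 0"
  using ip_scale_left[of "\<lambda>x. 0" f 0] by simp

lemma ip_zero_right [simp]: "f \<in> F \<Longrightarrow> ip f (\<lambda>x. 0) = 0"
  using ip_scale_right[of "\<lambda>x. 0" f 0] by simp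

lemma sum_mem [simp]: "(\<And>i. i \<in> I \<Longrightarrow> f i \<in> F) \<Longrightarrow> (\<lambda>x. \<Sum>i\<in>I. f i x) \<in> F"
  by (induction I rule: infinite_finite_induct) auto

lemma ip_sum_left:
  "(\<And>i. i \<in> I \<Longrightarrow> f i \<in> F) \<Longrightarrow> g \<in> F \<Longrightarrow> ip (\<lambda>x. \<Sum>i\<in>I. f i x) g = (\<Sum>i\<in>I. ip (f i) g)"
  by (induction I rule: infinite_finite_induct) auto

lemma nrm_power2 [simp]: "f \<in> F \<Longrightarrow> (nrm f)\<^sup>2 = ip f f"
  by (simp add: ip_norm_def)

lemma nrm_nonneg [simp]: "f \<in> F \<Longrightarrow> nrm f \<ge> 0"
  by (simp add: ip_norm_def)

lemma nrm_scale: "f \<in> F \<Longrightarrow> nrm (\<lambda>x. c * f x) = \<bar>c\<bar> * nrm f"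
  by (simp add: ip_norm_def real_sqrt_mult)

lemma ip_Cauchy_Schwarz_power2:
  assumes "f \<in> F" "g \<in> F" shows "(ip f g)\<^sup>2 \<le> ip f f * ip g g"
proof (cases "ip g g = 0")
  case True
  then have "g = (\<lambda>x. 0)" using assms by (simp add: ip_eq_0D)
  then show ?thesis using assms by simp
next
  case False
  then have pos: "ip g g > 0" using ip_nonneg[OF assms(2)] by linarith
  let ?h = "\<lambda>x. ip g g * f x - ip f g * g x"
  have "0 \<le> ip ?h ?h" using assms by (intro ip_nonneg) simp
  also have "ip ?h ?h = ip g g * (ip f f * ip g g - (ip f g)\<^sup>2)"
    using assms by (simp add: ip_commute[of g f]) (simp add: power2_eq_square algebra_simps)
  finally show ?thesis using pos by (simp add: zero_le_mult_iff)
qed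

lemma ip_Cauchy_Schwarz:
  assumes "f \<in> F" "g \<in> F" shows "\<bar>ip f g\<bar> \<le> nrm f * nrm g"
proof (rule power2_le_imp_le)
  show "\<bar>ip f g\<bar>\<^sup>2 \<le> (nrm f * nrm g)\<^sup>2"
    using ip_Cauchy_Schwarz_power2[OF assms] assms by (simp add: power_mult_distrib)
qed (use assms in simp)

lemma nrm_triangle:
  assumes "f \<in> F" "g \<in> F" shows "nrm (\<lambda>x. f x + g x) \<le> nrm f + nrm g"
proof (rule power2_le_imp_le)
  have "ip f g \<le> nrm f * nrm g" using ip_Cauchy_Schwarz[OF assms] by linarith
  then show "(nrm (\<lambda>x. f x + g x))\<^sup>2 \<le> (nrm f + nrm g)\<^sup>2"
    using assms by (simp add: power2_sum ip_commute[of g f])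
qed (use assms in simp)

lemma ip_tendsto:
  assumes "\<And>n. s n \<in> F" "f \<in> F" "g \<in> F" "(\<lambda>n. nrm (\<lambda>x. s n x - f x)) \<longlonglongrightarrow> 0"
  shows "(\<lambda>n. ip (s n) g) \<longlonglongrightarrow> ip f g"
proof -
  have "(\<lambda>n. nrm (\<lambda>x. s n x - f x) * nrm g) \<longlonglongrightarrow> 0"
    using tendsto_mult_left_zero[OF assms(4)] .
  moreover have "\<bar>ip (s n) g - ip f g\<bar> \<le> nrm (\<lambda>x. s n x - f x) * nrm g" for n
    using ip_Cauchy_Schwarz[of "\<lambda>x. s n x - f x" g] assms(1-3) by simp
  ultimately have "(\<lambda>n. ip (s n) g - ip f g) \<longlonglongrightarrow> 0"
    by (intro Lim_null_comparison[where f = "\<lambda>n. ip (s n) g - ip f g"]) auto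
  then show ?thesis by (simp add: LIM_zero_iff)
qed

text \<open>The uniform boundedness principle, by a gliding hump. If the norms were unbounded, pick
  \<open>a k\<close> among them with norm at least \<open>4 ^ k\<close> and add up steps of length \<open>1 / 3 ^ k\<close> in the
  directions \<open>\<plusminus> a k\<close>, with the sign that does not decrease the absolute value of the pairing with
  \<open>a k\<close>. The later steps together undo at most half of the \<open>k\<close>-th one, so the sum pairs with \<open>a k\<close>
  to at least \<open>(4/3) ^ k / 2\<close>.\<close>

lemma uniform_boundedness:
  assumes r: "\<And>n::nat. r n \<in> F" and bdd: "\<And>f. f \<in> F \<Longrightarrow> \<exists>B. \<forall>n. \<bar>ip f (r n)\<bar> \<le> B"
  shows "\<exists>C. \<forall>n. nrm (r n) \<le> C"
proof (rule ccontr)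
  assume "\<nexists>C. \<forall>n. nrm (r n) \<le> C"
  then have "\<forall>k::nat. \<exists>n. 4 ^ k \<le> nrm (r n)" by (meson linear)
  then obtain \<nu> where \<nu>: "\<And>k::nat. 4 ^ k \<le> nrm (r (\<nu> k))" by metis
  define a where "a k = r (\<nu> k)" for k
  have aF [simp]: "a k \<in> F" for k by (simp add: a_def r)
  have big: "4 ^ k \<le> nrm (a k)" for k using \<nu> by (simp add: a_def)
  have pos: "nrm (a k) > 0" for k using big[of k] by (meson less_le_trans zero_less_numeral zero_less_power)
  define c where "c k f = (if ip f (a k) \<ge> 0 then 1 else -1) / (3 ^ k * nrm (a k))" for k f
  define s where "s = rec_nat (\<lambda>x. 0) (\<lambda>k f x. f x + c k f * a k x)"
  have s_Suc: "s (Suc k) = (\<lambda>x. s k x + c k (s k) * a k x)" for k by (simp add: s_def)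
  have sF [simp]: "s k \<in> F" for k
    by (induction k) (simp_all add: s_Suc, simp add: s_def)
  have step: "nrm (\<lambda>x. s (Suc k) x - s k x) = 1 / 3 ^ k" for k
  proof -
    have "nrm (\<lambda>x. s (Suc k) x - s k x) = \<bar>c k (s k)\<bar> * nrm (a k)"
      by (simp add: s_Suc nrm_scale)
    then show ?thesis using pos[of k] by (simp add: c_def abs_mult)
  qed
  have tail: "nrm (\<lambda>x. s (i + d) x - s i x) \<le> 3 / 2 * (1 / 3 ^ i - 1 / 3 ^ (i + d))" for i d
  proof (induction d)
    case 0
    then show ?case by (simp add: ip_norm_def)
  next
    case (Suc d)
    have "nrm (\<lambda>x. s (i + Suc d) x - s i x)
        = nrm (\<lambda>x. (s (Suc (i + d)) x - s (i + d) x) + (s (i + d) x - s i x))" by simp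
    also have "\<dots> \<le> 1 / 3 ^ (i + d) + nrm (\<lambda>x. s (i + d) x - s i x)"
      using nrm_triangle[of "\<lambda>x. s (Suc (i + d)) x - s (i + d) x" "\<lambda>x. s (i + d) x - s i x"]
        step[of "i + d"] by simp
    also have "\<dots> \<le> 3 / 2 * (1 / 3 ^ i - 1 / 3 ^ (i + Suc d))"
    proof -
      have "N \<le> 3 / 2 * (A - B) \<Longrightarrow> B + N \<le> 3 / 2 * (A - B / 3)" for A B N :: real
        by (simp add: field_simps)
      from this[OF Suc.IH] show ?thesis by simp
    qed
    finally show ?case .
  qed
  have tail': "nrm (\<lambda>x. s j x - s i x) \<le> 3 / 2 * (1 / 3 ^ i)" if "i \<le> j" for i j
  proof -
    have "3 / 2 * (1 / 3 ^ i - 1 / 3 ^ j) \<le> (3 / 2 * (1 / 3 ^ i) :: real)"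
      by (intro mult_left_mono) auto
    moreover have "i + (j - i) = j" using that by simp
    ultimately show ?thesis using tail[of i "j - i"] by (simp only: order_trans)
  qed
  have sym: "nrm (\<lambda>x. f x - g x) = nrm (\<lambda>x. g x - f x)" if "f \<in> F" "g \<in> F" for f g
    using that by (simp add: ip_norm_def ip_commute)
  obtain f where f [simp]: "f \<in> F" and lim: "(\<lambda>n. nrm (\<lambda>x. s n x - f x)) \<longlonglongrightarrow> 0"
  proof (rule complete[of s])
    fix e :: real assume "e > 0"
    have "(\<lambda>n. 3 / 2 * (1 / 3) ^ n) \<longlonglongrightarrow> (0 :: real)"
      by (intro tendsto_mult_right_zero LIMSEQ_power_zero) simp
    then have "\<forall>\<^sub>F n in sequentially. 3 / 2 * (1 / 3) ^ n < e"
      using \<open>e > 0\<close> by (rule order_tendstoD(2))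
    then obtain N where N: "\<And>n. n \<ge> N \<Longrightarrow> 3 / 2 * (1 / 3) ^ n < e"
      by (auto simp: eventually_sequentially)
    have "nrm (\<lambda>x. s m x - s n x) < e" if "m \<ge> N" "n \<ge> N" for m n
    proof (cases "n \<le> m")
      case True
      then show ?thesis using tail'[of n m] N[OF that(2)] by (simp add: power_one_over)
    next
      case False
      then show ?thesis using tail'[of m n] N[OF that(1)] sym[of "s m" "s n"]
        by (simp add: power_one_over)
    qed
    then show "\<exists>N. \<forall>m\<ge>N. \<forall>n\<ge>N. nrm (\<lambda>x. s m x - s n x) < e" by blast
  qed auto
  \<comment> \<open>The factor \<open>1/2\<close> is the tail bound \<open>3/2 * (1 / 3 ^ Suc k)\<close> in units of the \<open>k\<close>-th step.\<close>
  have low: "(4 / 3) ^ k / 2 \<le> \<bar>ip f (a k)\<bar>" for k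
  proof -
    have sq: "ip (a k) (a k) = nrm (a k) * nrm (a k)"
      using nrm_power2[of "a k"] by (simp add: power2_eq_square)
    have hump: "1 / 3 ^ k * nrm (a k) \<le> \<bar>ip (s (Suc k)) (a k)\<bar>"
    proof -
      have "ip (s (Suc k)) (a k) = ip (s k) (a k) + c k (s k) * (nrm (a k) * nrm (a k))"
        by (simp add: s_Suc sq)
      then have "ip (s (Suc k)) (a k) = ip (s k) (a k)
          + (if ip (s k) (a k) \<ge> 0 then 1 / 3 ^ k * nrm (a k) else - (1 / 3 ^ k * nrm (a k)))"
        using pos[of k] by (simp add: c_def)
      moreover have "t \<le> \<bar>p + (if p \<ge> 0 then t else - t)\<bar>" for p t :: real by auto
      ultimately show ?thesis by metis
    qed
    have "\<bar>ip (s j) (a k) - ip (s (Suc k)) (a k)\<bar> \<le> 1 / 2 * (1 / 3 ^ k) * nrm (a k)"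
      if "j \<ge> Suc k" for j
    proof -
      have "\<bar>ip (s j) (a k) - ip (s (Suc k)) (a k)\<bar> \<le> nrm (\<lambda>x. s j x - s (Suc k) x) * nrm (a k)"
        using ip_Cauchy_Schwarz[of "\<lambda>x. s j x - s (Suc k) x" "a k"] by simp
      also have "\<dots> \<le> 1 / 2 * (1 / 3 ^ k) * nrm (a k)"
        using tail'[OF that] pos[of k] by (intro mult_right_mono) auto
      finally show ?thesis .
    qed
    moreover have "(\<lambda>j. \<bar>ip (s j) (a k) - ip (s (Suc k)) (a k)\<bar>)
        \<longlonglongrightarrow> \<bar>ip f (a k) - ip (s (Suc k)) (a k)\<bar>"
      by (intro tendsto_intros ip_tendsto lim) auto
    ultimately have "\<bar>ip f (a k) - ip (s (Suc k)) (a k)\<bar> \<le> 1 / 2 * (1 / 3 ^ k) * nrm (a k)"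
      by (intro LIMSEQ_le_const2) auto
    then have "1 / 2 * (1 / 3 ^ k) * nrm (a k) \<le> \<bar>ip f (a k)\<bar>" using hump by linarith
    moreover have "1 / 2 * (1 / 3 ^ k) * 4 ^ k \<le> 1 / 2 * (1 / 3 ^ k) * nrm (a k)"
      using big[of k] by (intro mult_left_mono) auto
    ultimately show ?thesis by (simp add: power_divide)
  qed
  obtain B where B: "\<And>n. \<bar>ip f (r n)\<bar> \<le> B" using bdd[OF f] by auto
  obtain k where "2 * B < (4 / 3) ^ k" using real_arch_pow[of "4 / 3" "2 * B"] by auto
  then show False using low[of k] B[of "\<nu> k"] by (simp add: a_def)
qed

text \<open>The Riesz representation theorem. The representer minimizes \<open>\<parallel>f\<parallel>\<^sup>2 - 2 L f\<close>: minimizing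
  sequences are Cauchy by the parallelogram law, and \<open>L g = \<langle>g, r\<rangle>\<close> says that the derivative
  at \<open>r\<close> in the direction \<open>g\<close> vanishes.\<close>

lemma Riesz_representation:
  assumes add: "\<And>f g. f \<in> F \<Longrightarrow> g \<in> F \<Longrightarrow> L (\<lambda>x. f x + g x) = L f + L g"
    and scale: "\<And>f c. f \<in> F \<Longrightarrow> L (\<lambda>x. c * f x) = c * L f"
    and bound: "\<And>f. f \<in> F \<Longrightarrow> \<bar>L f\<bar> \<le> C * nrm f"
  shows "\<exists>r\<in>F. \<forall>f\<in>F. L f = ip f r"
proof -
  define J where "J f = ip f f - 2 * L f" for f
  have low: "J f \<ge> - C\<^sup>2" if "f \<in> F" for f
  proof -
    have "0 \<le> (nrm f - C)\<^sup>2" by simp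
    also have "\<dots> = ip f f - 2 * (C * nrm f) + C\<^sup>2"
      using that by (simp only: power2_diff nrm_power2) simp
    finally show ?thesis using bound[OF that] by (simp add: J_def)
  qed
  define d where "d = (INF f\<in>F. J f)"
  have bb: "bdd_below (J ` F)" using low by (intro bdd_belowI2) auto
  have dle: "d \<le> J f" if "f \<in> F" for f
    unfolding d_def using bb that by (rule cINF_lower)
  have "\<exists>f\<in>F. J f < d + 1 / real (Suc n)" for n
    unfolding d_def using bb by (subst cINF_less_iff[symmetric]) (auto intro: zero_mem)
  then obtain s where s [simp]: "\<And>n. s n \<in> F" and sJ: "\<And>n. J (s n) < d + 1 / real (Suc n)"
    by metis
  have cauchy: "ip (\<lambda>x. s m x - s n x) (\<lambda>x. s m x - s n x) \<le> 2 * (1 / real (Suc m)) + 2 * (1 / real (Suc n))"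
    for m n
  proof -
    \<comment> \<open>The parallelogram law compares \<open>s m\<close> and \<open>s n\<close> with their midpoint, where \<open>J\<close> is at least \<open>d\<close>.\<close>
    define w where "w = (\<lambda>x. s m x + s n x)"
    have w: "w \<in> F" "L w = L (s m) + L (s n)"
      "ip w w = ip (s m) (s m) + 2 * ip (s m) (s n) + ip (s n) (s n)"
      by (simp_all add: w_def add ip_commute[of "s n" "s m"])
    have "J (\<lambda>x. 1 / 2 * w x) = ip w w / 4 - L w"
      using scale[OF w(1), of "1 / 2"] ip_scale_left[OF w(1) scale_mem[OF w(1)], of "1 / 2" "1 / 2"]
        ip_scale_right[OF w(1) w(1), of "1 / 2"]
      by (simp add: J_def)
    moreover have "d \<le> J (\<lambda>x. 1 / 2 * w x)" by (intro dle scale_mem w)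
    ultimately have "4 * d \<le> ip w w - 4 * L w" by linarith
    moreover have "ip (\<lambda>x. s m x - s n x) (\<lambda>x. s m x - s n x)
        = 2 * ip (s m) (s m) + 2 * ip (s n) (s n) - ip w w"
      by (simp add: w ip_commute[of "s n" "s m"])
    moreover have "ip (s m) (s m) < d + 1 / real (Suc m) + 2 * L (s m)"
      "ip (s n) (s n) < d + 1 / real (Suc n) + 2 * L (s n)"
      using sJ[of m] sJ[of n] by (simp_all add: J_def)
    moreover have "x \<le> 2 * \<delta> + 2 * \<epsilon>"
      if "4 * d \<le> y - 4 * (p + q)" "x = 2 * a + 2 * b - y" "a < d + \<delta> + 2 * p" "b < d + \<epsilon> + 2 * q"
      for a b p q x y \<delta> \<epsilon> :: real
      using that by (simp add: algebra_simps)
    ultimately show ?thesis unfolding w(2) by blast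
  qed
  obtain r where r [simp]: "r \<in> F" and lim: "(\<lambda>n. nrm (\<lambda>x. s n x - r x)) \<longlonglongrightarrow> 0"
  proof (rule complete[of s])
    fix e :: real assume "e > 0"
    then have "4 / e\<^sup>2 > 0" by simp
    obtain N where N: "4 / e\<^sup>2 < real N" using reals_Archimedean2 by blast
    have Np: "real N > 0" using N \<open>4 / e\<^sup>2 > 0\<close> by linarith
    have "nrm (\<lambda>x. s m x - s n x) < e" if "m \<ge> N" "n \<ge> N" for m n
    proof (rule power2_less_imp_less)
      have "2 / real (Suc m) \<le> 2 / real N" "2 / real (Suc n) \<le> 2 / real N"
        using that Np by (auto intro!: divide_left_mono)
      then have "(nrm (\<lambda>x. s m x - s n x))\<^sup>2 \<le> 4 / real N"
        using cauchy[of m n] nrm_power2[of "\<lambda>x. s m x - s n x"] by simp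
      also have "\<dots> < e\<^sup>2" using N Np \<open>e > 0\<close> by (simp add: field_simps)
      finally show "(nrm (\<lambda>x. s m x - s n x))\<^sup>2 < e\<^sup>2" .
    qed (use \<open>e > 0\<close> in simp)
    then show "\<exists>N. \<forall>m\<ge>N. \<forall>n\<ge>N. nrm (\<lambda>x. s m x - s n x) < e" by blast
  qed auto
  have "L g = ip g r" if g: "g \<in> F" for g
  proof -
    define a where "a = ip r g - L g"
    have ge: "0 \<le> 2 * t * a + t\<^sup>2 * ip g g" for t
    proof -
      have "0 \<le> 1 / real (Suc n) + 2 * t * (ip (s n) g - L g) + t\<^sup>2 * ip g g" for n
      proof -
        have "d \<le> J (\<lambda>x. s n x + t * g x)" by (intro dle add_mem scale_mem s g)
        also have "\<dots> = J (s n) + 2 * t * (ip (s n) g - L g) + t\<^sup>2 * ip g g"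
          using g by (simp add: J_def add scale ip_commute[of g "s n"] power2_eq_square algebra_simps)
        finally show ?thesis using sJ[of n] by linarith
      qed
      moreover have "(\<lambda>n. 1 / real (Suc n) + 2 * t * (ip (s n) g - L g) + t\<^sup>2 * ip g g)
          \<longlonglongrightarrow> 0 + 2 * t * (ip r g - L g) + t\<^sup>2 * ip g g"
        by (intro tendsto_intros ip_tendsto lim g r s LIMSEQ_Suc[OF lim_1_over_n])
      ultimately have "0 \<le> 0 + 2 * t * (ip r g - L g) + t\<^sup>2 * ip g g"
        by (intro LIMSEQ_le_const) auto
      then show ?thesis by (simp add: a_def)
    qed
    \<comment> \<open>Near the minimum of the quadratic in \<open>t\<close>; \<open>B + 1\<close> in place of \<open>B\<close> covers \<open>g = 0\<close>.\<close>
    define B where "B = ip g g"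
    have B: "B \<ge> 0" using g by (simp add: B_def)
    have "0 \<le> (2 * (- a / (B + 1)) * a + (- a / (B + 1))\<^sup>2 * B) * (B + 1)\<^sup>2"
      using ge[of "- a / (B + 1)"] by (intro mult_nonneg_nonneg) (auto simp: B_def)
    also have "\<dots> = - a\<^sup>2 * (B + 2)"
      using B by (simp add: power2_eq_square divide_simps) (simp add: algebra_simps)
    finally have "a\<^sup>2 * (B + 2) \<le> 0" by simp
    then have "a = 0" using B by (simp add: mult_le_0_iff)
    then show ?thesis using g by (simp add: a_def ip_commute)
  qed
  then show ?thesis using r by blast
qed

text \<open>Weak limits of representable functionals stay representable: the uniform boundedness
  principle makes the limit functional bounded.\<close>

lemma representable_limit:
  assumes r: "\<And>n::nat. r n \<in> F" and lim: "\<And>f. f \<in> F \<Longrightarrow> (\<lambda>n. ip f (r n)) \<longlonglongrightarrow> L f"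
  shows "\<exists>q\<in>F. \<forall>f\<in>F. L f = ip f q"
proof -
  have "\<exists>B. \<forall>n. \<bar>ip f (r n)\<bar> \<le> B" if "f \<in> F" for f
    using convergent_imp_Bseq[OF convergentI[OF lim[OF that]]] by (auto simp: Bseq_def)
  then obtain C where C: "\<And>n. nrm (r n) \<le> C" using uniform_boundedness[where r = r] r by blast
  show ?thesis
  proof (rule Riesz_representation)
    fix f g assume f: "f \<in> F" and g: "g \<in> F"
    have "(\<lambda>n. ip (\<lambda>x. f x + g x) (r n)) \<longlonglongrightarrow> L f + L g"
      using tendsto_add[OF lim[OF f] lim[OF g]] f g r by simp
    then show "L (\<lambda>x. f x + g x) = L f + L g"
      using LIMSEQ_unique lim[OF add_mem[OF f g]] by blast
  next
    fix f c assume f: "f \<in> F"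
    have "(\<lambda>n. ip (\<lambda>x. c * f x) (r n)) \<longlonglongrightarrow> c * L f"
      using tendsto_mult_left[OF lim[OF f]] f r by simp
    then show "L (\<lambda>x. c * f x) = c * L f"
      using LIMSEQ_unique lim[OF scale_mem[OF f]] by blast
  next
    fix f assume f: "f \<in> F"
    have "\<bar>ip f (r n)\<bar> \<le> C * nrm f" for n
      using ip_Cauchy_Schwarz[OF f r[of n]] mult_right_mono[OF C[of n] nrm_nonneg[OF f]]
      by (simp add: mult.commute)
    then show "\<bar>L f\<bar> \<le> C * nrm f"
      by (intro LIMSEQ_le_const2[OF tendsto_rabs[OF lim[OF f]]]) auto
  qed
qed


section \<open>Derivatives at a point are represented in a reproducing kernel Hilbert space\<close>

text \<open>Derivatives are limits of difference quotients, and a difference quotient of functionals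
  with representers is a functional with a representer.\<close>

lemma derivative_representer:
  assumes mem: "\<And>y. k y \<in> F" and eval: "\<And>f y. f \<in> F \<Longrightarrow> ip f (k y) = f y"
    and smooth: "F \<subseteq> torus_C n" and "j \<le> n"
  shows "\<exists>r\<in>F. \<forall>f\<in>F. (deriv ^^ j) f y = ip f r"
  using \<open>j \<le> n\<close>
proof (induction j arbitrary: y)
  case 0
  then show ?case using mem[of y] eval by (intro bexI[of _ "k y"]) auto
next
  case (Suc j)
  then have "\<forall>y. \<exists>r\<in>F. \<forall>f\<in>F. (deriv ^^ j) f y = ip f r" by simp
  then obtain q where q [simp]: "\<And>y. q y \<in> F"
    and qeq: "\<And>f y. f \<in> F \<Longrightarrow> (deriv ^^ j) f y = ip f (q y)" by metis
  define h where "h i = inverse (real (Suc i))" for i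
  have h: "filterlim h (at 0) sequentially"
    unfolding filterlim_at h_def using LIMSEQ_inverse_real_of_nat by auto
  let ?r = "\<lambda>i x. inverse (h i) * (q (y + h i) x - q y x)"
  have "\<exists>r\<in>F. \<forall>f\<in>F. deriv ((deriv ^^ j) f) y = ip f r"
  proof (rule representable_limit[where r = ?r])
    fix f assume f: "f \<in> F"
    then have "(deriv ^^ j) f differentiable (at y)"
      using smooth Suc.prems by (auto simp: torus_C_def differentiable_on_def)
    then have "((deriv ^^ j) f has_field_derivative deriv ((deriv ^^ j) f) y) (at y)"
      by (simp add: DERIV_deriv_iff_real_differentiable)
    then have "((\<lambda>t. ((deriv ^^ j) f (y + t) - (deriv ^^ j) f y) / t)
        \<longlongrightarrow> deriv ((deriv ^^ j) f) y) (at 0)"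
      by (simp add: DERIV_def)
    then have "(\<lambda>i. ((deriv ^^ j) f (y + h i) - (deriv ^^ j) f y) / h i)
        \<longlonglongrightarrow> deriv ((deriv ^^ j) f) y"
      using h by (rule filterlim_compose)
    then show "(\<lambda>i. ip f (?r i)) \<longlonglongrightarrow> deriv ((deriv ^^ j) f) y"
      using f by (simp add: qeq divide_inverse mult.commute)
  qed simp
  then show ?case by simp
qed

end

text \<open>Periodicity carries the reproducing property from the fundamental domain to all points.\<close>

lemma rkhs_reproducing:
  assumes "pos_def_kernel K" "rkhs K F ip"
  shows "K y \<in> F" and "f \<in> F \<Longrightarrow> ip f (K y) = f y"
proof -
  have per: "g (frac t) = g t" if "\<And>t. g (t + 1) = g t" for g :: "real \<Rightarrow> 'a" and t
  proof -
    interpret periodic_fun_simple' g by standard (rule that)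
    show ?thesis using minus_of_int[of t "\<lfloor>t\<rfloor>"] by (simp add: frac_def)
  qed
  have t: "frac y \<in> torus" by (simp add: torus_def frac_lt_1)
  have "K (t + 1) = K t" for t using assms(1) by (auto simp: pos_def_kernel_def)
  then have Ky: "K (frac y) = K y" by (rule per)
  show "K y \<in> F" using assms(2) t by (auto simp: rkhs_def Ky[symmetric])
  assume f: "f \<in> F"
  then have "f (frac y) = f y" using assms(2) by (intro per) (auto simp: rkhs_def torus_fun_def)
  then show "ip f (K y) = f y" using assms(2) t f unfolding rkhs_def Ky[symmetric] by metis
qed

section \<open>Minimal-norm interpolation\<close>

locale interpolation_problem = function_hilbert_space F ip
  for F :: "(real \<Rightarrow> real) set" and ip :: "(real \<Rightarrow> real) \<Rightarrow> (real \<Rightarrow> real) \<Rightarrow> real" +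
  fixes K :: "real \<Rightarrow> real \<Rightarrow> real"
    and L :: "'k::finite \<Rightarrow> (real \<Rightarrow> real) \<Rightarrow> real"
    and R :: "'k \<Rightarrow> real \<Rightarrow> real"
  assumes K_mem [simp]: "K y \<in> F" and reproducing: "f \<in> F \<Longrightarrow> ip f (K y) = f y"
    and R_mem [simp]: "R i \<in> F" and representer: "f \<in> F \<Longrightarrow> L i f = ip f (R i)"
    and invertible_gram: "invertible (gram K L)"
begin

definition inv_gram_form :: "real ^ 'k \<Rightarrow> real" where
  "inv_gram_form z = z \<bullet> (matrix_inv (gram K L) *v z)"

definition interpolant :: "real ^ 'k \<Rightarrow> real \<Rightarrow> real" where
  "interpolant z y = kernel_vec K L y \<bullet> (matrix_inv (gram K L) *v z)"

text \<open>A representer is determined by its pairings with the kernel sections, and these are the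
  data of the sections.\<close>

lemma kernel_vec_representer: "kernel_vec K L y $ i = R i y"
  by (simp add: kernel_vec_def representer ip_commute[of "K y"] reproducing)

lemma gram_representer: "gram K L $ i $ j = ip (R i) (R j)"
proof -
  have "L j (K y) = R j y" for y using kernel_vec_representer[of y j] by (simp add: kernel_vec_def)
  then show ?thesis by (simp add: gram_def representer ip_commute[of "R j"])
qed

lemma interpolant_eq:
  "interpolant z = (\<lambda>y. \<Sum>i\<in>UNIV. (matrix_inv (gram K L) *v z) $ i * R i y)"
  by (simp add: fun_eq_iff interpolant_def inner_vec_def kernel_vec_representer mult.commute)

lemma interpolant_mem [simp]: "interpolant z \<in> F"
  by (simp add: interpolant_eq)

lemma ip_interpolant:
  assumes "f \<in> F"
  shows "ip f (interpolant z) = (\<Sum>i\<in>UNIV. (matrix_inv (gram K L) *v z) $ i * L i f)"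
proof -
  have "ip f (interpolant z) = ip (interpolant z) f" using assms by (simp add: ip_commute)
  also have "\<dots> = (\<Sum>i\<in>UNIV. (matrix_inv (gram K L) *v z) $ i * L i f)"
    using assms by (simp add: interpolant_eq ip_sum_left representer ip_commute[of f])
  finally show ?thesis .
qed

lemma interpolant_interpolates: "L j (interpolant z) = z $ j"
proof -
  have "L j (interpolant z) = (gram K L *v (matrix_inv (gram K L) *v z)) $ j"
    by (simp add: representer ip_commute[of _ "R j"] ip_interpolant gram_representer
        matrix_vector_mult_def mult.commute)
  also have "gram K L *v (matrix_inv (gram K L) *v z) = z"
  proof -
    have "gram K L ** matrix_inv (gram K L) = mat 1"
      using someI_ex[OF invertible_gram[unfolded invertible_def]] by (simp add: matrix_inv_def)
    then show ?thesis by (simp add: matrix_vector_mul_assoc)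
  qed
  finally show ?thesis .
qed

lemma nrm_interpolant: "(nrm (interpolant z))\<^sup>2 = inv_gram_form z"
  by (simp add: ip_interpolant interpolant_interpolates inv_gram_form_def inner_vec_def mult.commute)

text \<open>The interpolant is the orthogonal projection of every function with the same data: it lies
  in the span of the representers, and pairing with these only sees the data.\<close>

lemma inv_gram_form_le_nrm:
  assumes "f \<in> F" shows "inv_gram_form (\<chi> i. L i f) \<le> (nrm f)\<^sup>2"
proof -
  let ?z = "\<chi> i. L i f"
  let ?g = "interpolant ?z"
  have "ip f ?g = inv_gram_form ?z"
    using assms by (simp add: ip_interpolant inv_gram_form_def inner_vec_def mult.commute)
  moreover have "ip ?g ?g = inv_gram_form ?z" using nrm_interpolant[of ?z] by simp
  moreover have "0 \<le> ip (\<lambda>x. f x - ?g x) (\<lambda>x. f x - ?g x)" using assms by (intro ip_nonneg) simp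
  ultimately show ?thesis using assms by (simp add: ip_commute[of ?g f])
qed

lemma inv_gram_form_nonneg: "0 \<le> inv_gram_form z"
  using nrm_interpolant[of z] by (metis zero_le_power2)

text \<open>Coercivity of the quadratic form is the boundedness of the data functionals, tested on
  the interpolant.\<close>

lemma inv_gram_form_coercive: "(z $ i)\<^sup>2 \<le> ip (R i) (R i) * inv_gram_form z"
  using ip_Cauchy_Schwarz_power2[of "interpolant z" "R i"] nrm_interpolant[of z]
    interpolant_interpolates[of i z]
  by (simp add: representer mult.commute)

end

section \<open>Existence of a minimizer of the finite-dimensional problem\<close>

text \<open>The constraint with the logarithm determines the density, and in this form positivity is
  automatic. So the feasible set is closed.\<close>

lemma F_feasible_iff:
  "F_feasible V b x p \<longleftrightarrow>
     (\<forall>i. fst (snd p) $ Inl i = exp (hamiltonian V b (x i) (fst p $ Inr (Inl i)) - snd (snd p)) \<and>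
          fst (snd p) $ Inr i * (fst p $ Inr (Inl i) + b (x i))
            + fst (snd p) $ Inl i * (fst p $ Inr (Inr i) + deriv b (x i)) = 0)"
proof -
  have "\<rho> > 0 \<and> H = ln \<rho> + l \<longleftrightarrow> \<rho> = exp (H - l)" for \<rho> H l :: real by auto
  then show ?thesis by (cases p) (simp add: F_feasible_def conj_assoc[symmetric])
qed

lemma closed_F_feasible: "closed {p. F_feasible V b x p}"
  unfolding F_feasible_iff hamiltonian_def
  by (intro closed_Collect_all closed_Collect_conj closed_Collect_eq continuous_intros) simp_all

lemma continuous_F_objective: "continuous_on UNIV (F_objective K1 K2 \<beta> x)"
  unfolding F_objective_def case_prod_unfold
  by (intro continuous_intros bounded_linear.continuous_on[OF matrix_vector_mul_bounded_linear])

text \<open>Zero momentum, density \<open>exp V\<close> and constant \<open>0\<close> solve the first constraint; the data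
  left free then solve the second one.\<close>

lemma F_feasible_exists:
  fixes x :: "'n::finite \<Rightarrow> real"
  shows "\<exists>p. F_feasible V b x p"
proof -
  define z :: "real ^ ('n + 'n + 'n)" where
    "z = (\<chi> k. case k of Inr (Inr i) \<Rightarrow> - deriv b (x i) | _ \<Rightarrow> 0)"
  define \<rho> :: "real ^ ('n + 'n)" where
    "\<rho> = (\<chi> k. case k of Inl i \<Rightarrow> exp (V (x i)) | _ \<Rightarrow> 0)"
  have "F_feasible V b x (z, \<rho>, 0)"
    by (simp add: F_feasible_def hamiltonian_def z_def \<rho>_def)
  then show ?thesis ..
qed

text \<open>Coercivity is assumed coordinate by coordinate, in the form in which boundedness of the data
  functionals provides it.\<close>

lemma F_minimizer_exists:
  fixes K1 K2 :: "real \<Rightarrow> real \<Rightarrow> real"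
    and x :: "'n::finite \<Rightarrow> real" and C :: "'n + 'n + 'n \<Rightarrow> real" and D :: "'n + 'n \<Rightarrow> real"
  defines "Q1 \<equiv> \<lambda>z. z \<bullet> (matrix_inv (gram K1 (phi x)) *v z)"
    and "Q2 \<equiv> \<lambda>\<rho>. \<rho> \<bullet> (matrix_inv (gram K2 (psi x)) *v \<rho>)"
  assumes \<beta>: "\<beta> \<ge> 0"
    and Q1: "\<And>z. 0 \<le> Q1 z" "\<And>z k. (z $ k)\<^sup>2 \<le> C k * Q1 z" "\<And>k. 0 \<le> C k"
    and Q2: "\<And>\<rho>. 0 \<le> Q2 \<rho>" "\<And>\<rho> k. (\<rho> $ k)\<^sup>2 \<le> D k * Q2 \<rho>" "\<And>k. 0 \<le> D k"
  shows "\<exists>p. is_arg_min (F_objective K1 K2 \<beta> x) (F_feasible V b x) p"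
proof -
  let ?J = "F_objective K1 K2 \<beta> x"
  obtain p0 where p0: "F_feasible V b x p0" using F_feasible_exists by blast
  define c where "c = ?J p0"
  define S where "S = {p. F_feasible V b x p} \<inter> {p. ?J p \<le> c}"
  have coord: "norm v \<le> (\<Sum>k\<in>UNIV. sqrt (C k * c))"
    if "\<And>k. (v $ k)\<^sup>2 \<le> C k * q" "\<And>k. 0 \<le> C k" "q \<le> c" for v :: "real ^ 'k::finite" and C q
  proof -
    have "\<bar>v $ k\<bar> \<le> sqrt (C k * c)" for k
      using order_trans[OF that(1) mult_left_mono[OF that(3) that(2)], of k]
      by (intro real_le_rsqrt) simp
    then show ?thesis by (intro order_trans[OF norm_le_l1_cart] sum_mono)
  qed
  have "S \<subseteq> cball 0 (\<Sum>k\<in>UNIV. sqrt (C k * c)) \<times> cball 0 (\<Sum>k\<in>UNIV. sqrt (D k * c))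
      \<times> cball 0 (sqrt c)"
  proof
    fix p assume "p \<in> S"
    then obtain z \<rho> l where p: "p = (z, \<rho>, l)" and J: "?J (z, \<rho>, l) \<le> c"
      by (cases p) (auto simp: S_def)
    have "Q1 z + Q2 \<rho> + l\<^sup>2 \<le> ?J (z, \<rho>, l)"
      using \<beta> by (simp add: F_objective_def Q1_def Q2_def)
    then have "Q1 z \<le> c" "Q2 \<rho> \<le> c" "l\<^sup>2 \<le> c"
      using J Q1(1)[of z] Q2(1)[of \<rho>] zero_le_power2[of l] by linarith+
    then show "p \<in> cball 0 (\<Sum>k\<in>UNIV. sqrt (C k * c)) \<times> cball 0 (\<Sum>k\<in>UNIV. sqrt (D k * c))
      \<times> cball 0 (sqrt c)"
      using coord[OF Q1(2,3)] coord[OF Q2(2,3)] by (simp add: p real_le_rsqrt)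
  qed
  then have "bounded S" by (rule bounded_subset[rotated]) (intro bounded_Times bounded_cball)
  moreover have "closed S"
    unfolding S_def by (intro closed_Int closed_F_feasible closed_Collect_le
        continuous_F_objective continuous_on_const)
  ultimately have "compact S" by (simp add: compact_eq_bounded_closed)
  moreover have "p0 \<in> S" using p0 by (simp add: S_def c_def)
  ultimately obtain p where "p \<in> S" and min: "\<And>q. q \<in> S \<Longrightarrow> ?J p \<le> ?J q"
    using continuous_attains_inf[of S ?J] continuous_on_subset[OF continuous_F_objective] by blast
  then have "is_arg_min ?J (F_feasible V b x) p"
    unfolding is_arg_min_def S_def by fastforce
  then show ?thesis ..
qed

section \<open>Equivalence of the two problems\<close>

theorem theorem2p3:
  fixes V b :: "real \<Rightarrow> real"
    and \<beta> :: real
    and x :: "'n::finite \<Rightarrow> real"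
    and K1 K2 :: "real \<Rightarrow> real \<Rightarrow> real"
    and FU FV :: "(real \<Rightarrow> real) set"
    and ipU ipV :: "(real \<Rightarrow> real) \<Rightarrow> (real \<Rightarrow> real) \<Rightarrow> real"
  assumes "V \<in> torus_smooth" and "b \<in> torus_smooth"
    and "integral {0..1} b = 0"
    and "\<beta> > 0"
    and "\<forall>i. x i \<in> torus"
    and "pos_def_kernel K1" and "pos_def_kernel K2"
    and "rkhs K1 FU ipU" and "rkhs K2 FV ipV"
    and "FU \<subseteq> torus_C 2" and "FV \<subseteq> torus_C 1"
    and "invertible (gram K1 (phi x))" and "invertible (gram K2 (psi x))"
  shows "\<exists>u m h z \<rho> l.
    is_arg_min (P_objective ipU ipV \<beta> x) (P_feasible FU FV V b x) (u, m, h) \<and>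
    is_arg_min (F_objective K1 K2 \<beta> x) (F_feasible V b x) (z, \<rho>, l) \<and>
    (\<forall>y. u y = kernel_vec K1 (phi x) y \<bullet> (matrix_inv (gram K1 (phi x)) *v z)) \<and>
    (\<forall>y. m y = kernel_vec K2 (psi x) y \<bullet> (matrix_inv (gram K2 (psi x)) *v \<rho>)) \<and>
    h = l"
proof -
  have U: "function_hilbert_space FU ipU" and V: "function_hilbert_space FV ipV"
    using assms(8,9) by (auto simp: rkhs_def function_hilbert_space_def)
  have "\<exists>r\<in>FU. \<forall>f\<in>FU. dirac_deriv j y f = ipU f r" if "j \<le> 2" for j y
    unfolding dirac_deriv_def
    by (intro function_hilbert_space.derivative_representer[OF U, where k = K1 and n = 2]
        rkhs_reproducing[OF assms(6,8)] assms(10) that)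
  then have "\<exists>r\<in>FU. \<forall>f\<in>FU. phi x k f = ipU f r" for k
    by (cases "(x, k)" rule: phi.cases) auto
  then obtain R1 where R1: "\<And>k. R1 k \<in> FU" "\<And>k f. f \<in> FU \<Longrightarrow> phi x k f = ipU f (R1 k)" by metis
  have "\<exists>r\<in>FV. \<forall>f\<in>FV. dirac_deriv j y f = ipV f r" if "j \<le> 1" for j y
    unfolding dirac_deriv_def
    by (intro function_hilbert_space.derivative_representer[OF V, where k = K2 and n = 1]
        rkhs_reproducing[OF assms(7,9)] assms(11) that)
  then have "\<exists>r\<in>FV. \<forall>f\<in>FV. psi x k f = ipV f r" for k
    by (cases "(x, k)" rule: psi.cases) auto
  then obtain R2 where R2: "\<And>k. R2 k \<in> FV" "\<And>k f. f \<in> FV \<Longrightarrow> psi x k f = ipV f (R2 k)" by metis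
  interpret U: interpolation_problem FU ipU K1 "phi x" R1
    by (intro interpolation_problem.intro interpolation_problem_axioms.intro U R1 assms(12)
        rkhs_reproducing[OF assms(6,8)])
  interpret V: interpolation_problem FV ipV K2 "psi x" R2
    by (intro interpolation_problem.intro interpolation_problem_axioms.intro V R2 assms(13)
        rkhs_reproducing[OF assms(7,9)])
  let ?P = "P_objective ipU ipV \<beta> x" and ?F = "F_objective K1 K2 \<beta> x"
  have "\<exists>p. is_arg_min ?F (F_feasible V b x) p"
    using assms(4)
    by (intro F_minimizer_exists[where C = "\<lambda>k. ipU (R1 k) (R1 k)" and D = "\<lambda>k. ipV (R2 k) (R2 k)"]
        U.inv_gram_form_nonneg[unfolded U.inv_gram_form_def] U.inv_gram_form_coercive[unfolded U.inv_gram_form_def]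
        V.inv_gram_form_nonneg[unfolded V.inv_gram_form_def] V.inv_gram_form_coercive[unfolded V.inv_gram_form_def]
        U.ip_nonneg V.ip_nonneg R1 R2) auto
  then obtain z \<rho> l where min: "is_arg_min ?F (F_feasible V b x) (z, \<rho>, l)" by auto
  define dataU where "dataU u = (\<chi> k. phi x k u)" for u
  define dataV where "dataV m = (\<chi> k. psi x k m)" for m
  have feas: "P_feasible FU FV V b x (u, m, h) \<longleftrightarrow> F_feasible V b x (dataU u, dataV m, h)"
    if "u \<in> FU" "m \<in> FV" for u m h
    using that by (simp add: P_feasible_def F_feasible_def dataU_def dataV_def dirac_deriv_def
        numeral_2_eq_2)
  \<comment> \<open>The objectives differ by the norm that is lost in passing to the interpolants.\<close>
  have obj: "?P (u, m, h) = (ip_norm ipU u)\<^sup>2 - U.inv_gram_form (dataU u)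
      + ((ip_norm ipV m)\<^sup>2 - V.inv_gram_form (dataV m))
      + ?F (dataU u, dataV m, h)" for u m h
    by (simp add: P_objective_def F_objective_def U.inv_gram_form_def V.inv_gram_form_def
        dataU_def dataV_def dirac_deriv_def)
  let ?u = "U.interpolant z" and ?m = "V.interpolant \<rho>"
  have data: "dataU ?u = z" "dataV ?m = \<rho>"
    by (simp_all add: vec_eq_iff dataU_def dataV_def U.interpolant_interpolates
        V.interpolant_interpolates)
  have "is_arg_min ?P (P_feasible FU FV V b x) (?u, ?m, l)"
    unfolding is_arg_min_def
  proof (intro conjI notI; (elim exE conjE)?)
    show "P_feasible FU FV V b x (?u, ?m, l)"
      using min by (simp add: feas data is_arg_min_def)
  next
    fix p assume pf: "P_feasible FU FV V b x p" and less: "?P p < ?P (?u, ?m, l)"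
    obtain u m h where p: "p = (u, m, h)" by (cases p)
    have mem: "u \<in> FU" "m \<in> FV" using pf by (auto simp: p P_feasible_def)
    have "?F (dataU u, dataV m, h) \<le> ?P (u, m, h)"
      using U.inv_gram_form_le_nrm[OF mem(1)] V.inv_gram_form_le_nrm[OF mem(2)] by (simp add: obj dataU_def dataV_def)
    also have "\<dots> < ?F (z, \<rho>, l)"
      using less by (simp add: p obj data U.nrm_interpolant V.nrm_interpolant 
          del: U.nrm_power2 V.nrm_power2)
    finally show False using min pf by (auto simp: p feas mem is_arg_min_def)
  qed
  then show ?thesis using min unfolding U.interpolant_def V.interpolant_def by blast
qed

end
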